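(* Let $X$ be a max-stable random field on a metric space $T$ with standard Fréchet marginals, $\theta$ its extremal coefficient function, $\chi$ its extremal correlation function, and $\eta:=1-\chi$. Let $X^*$ be the max-linear max-stable random field associated with $\theta$ (see context). Then: a) If $X$ is stochastically continuous, then $\theta$ is continuous; and if $\theta$ is continuous, then $\chi$ is continuous. b) For all $s,t\in T$ and any $\varepsilon>0$, $$\mathbb P(|X^*_s-X^*_t|>\varepsilon)\le 2\left(1-\exp\left(-\frac{\eta(s,t)}{\varepsilon}\right)\right)\le\frac2\varepsilon\,\eta(s,t).$$ c) If $\chi$ is continuous, then $X^*$ is stochastically continuous.
   Context: A random field $X=\{X_t\}_{t\in T}$ has standard Fréchet marginals if $\mathbb P(X_t\le x)=e^{-1/x}$ for all $t\in T$, $x\ge 0$ (value $0$ at $x=0$). Such a field is max-stable if for every $n\ge1$ and independent copies $X^{(1)},\dots,X^{(n)}$ of $X$ the field $n^{-1}\max_{i}X^{(i)}$ has the same (finite-dimensional) distributions as $X$. $\mathcal F(T)$ denotes the set of finite subsets of $T$. The extremal coefficient function is $\theta:\mathcal F(T)\to[0,\infty)$, $\theta(\emptyset):=0$, $\theta(M):=-x\log\mathbb P(\max_{t\in M}X_t\le x)$ for non-empty finite $M$ and any $x\in(0,\infty)$ (independent of $x$). The extremal correlation function is $\chi:T\times T\to[0,1]$, $\chi(s,t):=\lim_{x\uparrow\infty}\mathbb P(X_s\ge x\mid X_t\ge x)$; it satisfies $\chi(s,t)=2-\theta(\{s,t\})$. A function $f:\mathcal F(T)\to\mathbb R$ is continuous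 if for all $m\ge0$ the induced function $f^{(m)}:T^m\to\mathbb R$, $f^{(m)}(t_1,\dots,t_m)=f(\{t_1,\dots,t_m\})$, is continuous. A random field $X$ on a metric space $T$ is stochastically continuous if $X_{t_n}\to X_t$ in probability whenever $t_n\to t$ in $T$. The field $X^*=\{X^*_t\}_{t\in T}$ associated with $\theta$ is the random field with finite-dimensional distributions $$-\log\mathbb P(X^*_t\le x_t,\ t\in M)=\sum_{\emptyset\neq L\subset M}\tau^M_L\max_{t\in L}\frac1{x_t},\qquad \tau^M_L:=\sum_{I\subset L}(-1)^{|I|+1}\theta\big((M\setminus L)\cup I\big),$$ for non-empty finite $M\subset T$. It is well defined (in particular $\tau^M_L\ge0$), max-stable with standard Fréchet marginals, and has extremal coefficient function $\theta$ (hence extremal correlation function $\chi$). *)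

theory Defs
  imports "HOL-Probability.Probability"
begin

definition random_field :: "'w measure \<Rightarrow> ('t \<Rightarrow> 'w \<Rightarrow> real) \<Rightarrow> bool" where
  "random_field M X \<longleftrightarrow> prob_space M \<and> (\<forall>t. X t \<in> borel_measurable M)"

text \<open>The case distinction is needed because \<open>- 1 / 0 = 0\<close> in HOL, so that \<open>exp (- 1 / 0) = 1\<close>.\<close>

definition standard_frechet :: "'w measure \<Rightarrow> ('t \<Rightarrow> 'w \<Rightarrow> real) \<Rightarrow> bool" where
  "standard_frechet M X \<longleftrightarrow>
     (\<forall>t. \<forall>x\<ge>0. \<P>(\<omega> in M. X t \<omega> \<le> x) = (if x = 0 then 0 else exp (- 1 / x)))"

definition same_fdd ::
    "'w measure \<Rightarrow> ('t \<Rightarrow> 'w \<Rightarrow> real) \<Rightarrow> 'v measure \<Rightarrow> ('t \<Rightarrow> 'v \<Rightarrow> real) \<Rightarrow> bool" where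
  "same_fdd M X N Y \<longleftrightarrow>
     (\<forall>A. finite A \<longrightarrow>
        distr M (Pi\<^sub>M A (\<lambda>_. borel)) (\<lambda>\<omega>. \<lambda>t\<in>A. X t \<omega>) =
        distr N (Pi\<^sub>M A (\<lambda>_. borel)) (\<lambda>\<omega>. \<lambda>t\<in>A. Y t \<omega>))"

text \<open>Independence is that of the whole fields \<open>Z i\<close>, as random elements of \<open>\<real>\<^sup>T\<close>.\<close>

definition independent_copies ::
    "'w measure \<Rightarrow> ('t \<Rightarrow> 'w \<Rightarrow> real) \<Rightarrow> nat \<Rightarrow> 'v measure \<Rightarrow> (nat \<Rightarrow> 't \<Rightarrow> 'v \<Rightarrow> real) \<Rightarrow> bool" where
  "independent_copies M X n N Z \<longleftrightarrow>
     prob_space N \<and>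
     (\<forall>i<n. random_field N (Z i) \<and> same_fdd N (Z i) M X) \<and>
     prob_space.indep_vars N (\<lambda>_. Pi\<^sub>M UNIV (\<lambda>_. borel)) (\<lambda>i \<omega> t. Z i t \<omega>) {..<n}"

text \<open>A definition cannot quantify over types, so the copies range over the probability spaces on
  \<open>nat \<Rightarrow> 'w\<close>. The product space \<open>Pi\<^sub>M {..<n} (\<lambda>_. M)\<close> is one of these, so copies always exist;
  and the law of the maximum depends only on \<open>n\<close> and the law of \<open>X\<close>, so nothing is lost.\<close>

definition max_stable :: "'w measure \<Rightarrow> ('t \<Rightarrow> 'w \<Rightarrow> real) \<Rightarrow> bool" where
  "max_stable M X \<longleftrightarrow>
     (\<forall>n\<ge>1. \<forall>(N :: (nat \<Rightarrow> 'w) measure) Z. independent_copies M X n N Z \<longrightarrow>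
        same_fdd N (\<lambda>t \<omega>. (MAX i\<in>{..<n}. Z i t \<omega>) / real n) M X)"

text \<open>The common value of \<open>- x * ln (P (max \<le> x))\<close> over all \<open>x > 0\<close>; for a max-stable field with
  standard Frechet marginals this expression does not depend on \<open>x\<close>. Only the values on finite
  sets are meaningful.\<close>

definition extremal_coefficient :: "'w measure \<Rightarrow> ('t \<Rightarrow> 'w \<Rightarrow> real) \<Rightarrow> 't set \<Rightarrow> real" where
  "extremal_coefficient M X A =
     (if A = {} then 0
      else (THE c. \<forall>x>0. c = - x * ln (\<P>(\<omega> in M. (MAX t\<in>A. X t \<omega>) \<le> x))))"

definition extremal_correlation :: "'w measure \<Rightarrow> ('t \<Rightarrow> 'w \<Rightarrow> real) \<Rightarrow> 't \<Rightarrow> 't \<Rightarrow> real" where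
  "extremal_correlation M X s t = Lim at_top (\<lambda>x. \<P>(\<omega> in M. X s \<omega> \<ge> x \<bar> X t \<omega> \<ge> x))"

text \<open>\<open>T\<^sup>m\<close> is the space of extensional functions from \<open>{..<m}\<close>, with the product topology.\<close>

definition continuous_finset_fun :: "('t::topological_space set \<Rightarrow> real) \<Rightarrow> bool" where
  "continuous_finset_fun f \<longleftrightarrow>
     (\<forall>m::nat. continuous_map (product_topology (\<lambda>_. euclidean) {..<m}) euclideanreal
        (\<lambda>t. f (t ` {..<m})))"

definition stochastically_continuous ::
    "'w measure \<Rightarrow> ('t::metric_space \<Rightarrow> 'w \<Rightarrow> real) \<Rightarrow> bool" where
  "stochastically_continuous M X \<longleftrightarrow>
     (\<forall>u t. u \<longlonglongrightarrow> t \<longrightarrow>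
        (\<forall>\<epsilon>>0. (\<lambda>n. \<P>(\<omega> in M. \<bar>X (u n) \<omega> - X t \<omega>\<bar> > \<epsilon>)) \<longlonglongrightarrow> 0))"

definition tau :: "('t set \<Rightarrow> real) \<Rightarrow> 't set \<Rightarrow> 't set \<Rightarrow> real" where
  "tau \<theta> A L = (\<Sum>I\<in>Pow L. (-1) ^ (card I + 1) * \<theta> ((A - L) \<union> I))"

text \<open>The formula for \<open>- ln P\<close> is written in exponential form because \<open>ln 0 = 0\<close> in HOL.
  The law of the field on \<open>A\<close> is determined by the \<open>x\<close> with positive coordinates.\<close>

definition associated_field ::
    "('t set \<Rightarrow> real) \<Rightarrow> 'v measure \<Rightarrow> ('t \<Rightarrow> 'v \<Rightarrow> real) \<Rightarrow> bool" where
  "associated_field \<theta> N Y \<longleftrightarrow>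
     random_field N Y \<and>
     (\<forall>A x. finite A \<longrightarrow> A \<noteq> {} \<longrightarrow> (\<forall>t\<in>A. x t > 0) \<longrightarrow>
        \<P>(\<omega> in N. \<forall>t\<in>A. Y t \<omega> \<le> x t) =
        exp (- (\<Sum>L\<in>Pow A - {{}}. tau \<theta> A L * (MAX t\<in>L. 1 / x t))))"

end

theory Submission
  imports Defs "HOL-Real_Asymp.Real_Asymp"
begin

text \<open>Comparing \<open>X\<close> with the copies of \<open>X\<close> on the product space, max-stability makes
  \<open>x \<mapsto> - ln P (max\<^sub>A X \<le> x)\<close> homogeneous of degree \<open>-1\<close>, first for rational and by monotonicity for
  all factors; hence \<open>P (max\<^sub>A X \<le> x) = exp (- \<theta> A / x)\<close> and \<open>\<chi> s t = 2 - \<theta> {s, t}\<close>.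
  A union bound over the events \<open>X\<^bsub>t i\<^esub> \<le> x < X\<^bsub>s i\<^esub>\<close> shows that \<open>\<theta>\<close> varies between two
  \<open>m\<close>-tuples by at most the sum of the \<open>\<eta> (s i) (t i)\<close>, so continuity of \<open>\<theta>\<close> reduces to
  \<open>\<eta> (u n) t \<longlonglongrightarrow> 0\<close>. For \<open>X\<^sup>*\<close> the two-dimensional distribution function factorises as
  \<open>exp (- \<eta> / a) * exp (- 1 / b)\<close> for \<open>b \<le> a\<close>, which gives the bound in part b) without representing
  \<open>X\<^sup>*\<close> by independent Frechet variables; part c) follows by squeezing.\<close>

section \<open>Max-stability as a power identity for the law of a maximum\<close>

text \<open>The event is the preimage of a box in the product over \<open>A\<close>; finiteness of
  \<open>A\<close> makes the box measurable, so equal image measures give it equal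
  probability.\<close>

lemma same_fdd_prob_le:
  fixes X :: "'t \<Rightarrow> 'w \<Rightarrow> real" and Y :: "'t \<Rightarrow> 'v \<Rightarrow> real"
  assumes "same_fdd M X N Y" and A: "finite A"
    and X: "\<And>t. t \<in> A \<Longrightarrow> X t \<in> borel_measurable M"
    and Y: "\<And>t. t \<in> A \<Longrightarrow> Y t \<in> borel_measurable N"
  shows "\<P>(\<omega> in M. \<forall>t\<in>A. X t \<omega> \<le> x t) = \<P>(\<omega> in N. \<forall>t\<in>A. Y t \<omega> \<le> x t)"
proof -
  let ?P = "Pi\<^sub>M A (\<lambda>_. borel :: real measure)"
  have S: "Pi\<^sub>E A (\<lambda>t. {..x t}) \<in> sets ?P"
    using A by (intro sets_PiM_I_finite) auto
  have eq: "distr M ?P (\<lambda>\<omega>. \<lambda>t\<in>A. X t \<omega>) = distr N ?P (\<lambda>\<omega>. \<lambda>t\<in>A. Y t \<omega>)"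
    using assms(1) A unfolding same_fdd_def by blast
  have mX: "(\<lambda>\<omega>. \<lambda>t\<in>A. X t \<omega>) \<in> measurable M ?P"
    using X by (rule measurable_restrict)
  have mY: "(\<lambda>\<omega>. \<lambda>t\<in>A. Y t \<omega>) \<in> measurable N ?P"
    using Y by (rule measurable_restrict)
  have "\<P>(\<omega> in M. \<forall>t\<in>A. X t \<omega> \<le> x t)
      = measure (distr M ?P (\<lambda>\<omega>. \<lambda>t\<in>A. X t \<omega>)) (Pi\<^sub>E A (\<lambda>t. {..x t}))"
    by (subst measure_distr[OF mX S]) (auto intro!: arg_cong[where f="measure M"] split: if_splits)
  also have "\<dots> = \<P>(\<omega> in N. \<forall>t\<in>A. Y t \<omega> \<le> x t)"
    unfolding eq
    by (subst measure_distr[OF mY S]) (auto intro!: arg_cong[where f="measure N"] split: if_splits)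
  finally show ?thesis .
qed

text \<open>\<open>max_stable\<close> speaks only about copies that are given, so some must be
  exhibited. The coordinates of the product space are independent because their joint law is the
  product of their laws, and this passes to the fields evaluated at them.\<close>

lemma independent_copies_PiM:
  fixes X :: "'t \<Rightarrow> 'w \<Rightarrow> real"
  assumes "random_field M X" and n: "n \<ge> 1"
  shows "independent_copies M X n (Pi\<^sub>M {..<n} (\<lambda>_. M)) (\<lambda>i t \<omega>. X t (\<omega> i))"
proof -
  let ?N = "Pi\<^sub>M {..<n} (\<lambda>_. M)"
  interpret prob_space M using assms(1) by (simp add: random_field_def)
  have X [measurable]: "X t \<in> borel_measurable M" for t
    using assms(1) by (simp add: random_field_def)
  interpret N: prob_space ?N
    by (rule prob_space_PiM) (rule prob_space_axioms)
  have comp [measurable]: "(\<lambda>\<omega>. \<omega> i) \<in> measurable ?N M" if "i < n" for i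
    using that by simp
  have "N.indep_vars (\<lambda>_. M) (\<lambda>i \<omega>. \<omega> i) {..<n}"
  proof (subst N.indep_vars_iff_distr_eq_PiM')
    show "{..<n} \<noteq> {}" using n by (simp add: lessThan_empty_iff)
    \<comment> \<open>Points of the product space are already extensional on the index set, so
      restricting them changes nothing.\<close>
    have "distr ?N ?N (\<lambda>x. \<lambda>i\<in>{..<n}. x i) = distr ?N ?N (\<lambda>x. x)"
      by (rule distr_cong) (auto simp: space_PiM)
    moreover have "(\<Pi>\<^sub>M i\<in>{..<n}. distr ?N M (\<lambda>\<omega>. \<omega> i)) = ?N"
      by (intro PiM_cong distr_PiM_component) (auto simp: prob_space_axioms)
    ultimately show "distr ?N ?N (\<lambda>x. \<lambda>i\<in>{..<n}. x i) = (\<Pi>\<^sub>M i\<in>{..<n}. distr ?N M (\<lambda>\<omega>. \<omega> i))"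
      by (simp add: distr_id)
  qed simp
  then have "N.indep_vars (\<lambda>_. Pi\<^sub>M UNIV (\<lambda>_. borel)) (\<lambda>i \<omega>. (\<lambda>w t. X t w) (\<omega> i)) {..<n}"
    by (rule N.indep_vars_compose2) (rule measurable_PiM_single', auto)
  moreover have "same_fdd ?N (\<lambda>t \<omega>. X t (\<omega> i)) M X" if i: "i < n" for i
    unfolding same_fdd_def
  proof (intro allI impI)
    fix A :: "'t set"
    have "distr ?N (Pi\<^sub>M A (\<lambda>_. borel)) (\<lambda>\<omega>. \<lambda>t\<in>A. X t (\<omega> i))
        = distr (distr ?N M (\<lambda>\<omega>. \<omega> i)) (Pi\<^sub>M A (\<lambda>_. borel)) (\<lambda>\<omega>. \<lambda>t\<in>A. X t \<omega>)"
      using i by (subst distr_distr) (auto simp: comp_def)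
    also have "distr ?N M (\<lambda>\<omega>. \<omega> i) = M"
      using i by (intro distr_PiM_component) (auto simp: prob_space_axioms)
    finally show "distr ?N (Pi\<^sub>M A (\<lambda>_. borel)) (\<lambda>\<omega>. \<lambda>t\<in>A. X t (\<omega> i))
        = distr M (Pi\<^sub>M A (\<lambda>_. borel)) (\<lambda>\<omega>. \<lambda>t\<in>A. X t \<omega>)" .
  qed
  ultimately show ?thesis
    unfolding independent_copies_def random_field_def
    by (auto simp: N.prob_space_axioms)
qed

text \<open>Test max-stability on the coordinate copies: the scaled maximum is at most
  \<open>x\<close> on \<open>A\<close> iff every copy is at most \<open>n * x\<close> on
  \<open>A\<close>, an event of product form with \<open>n\<close> equal factors.\<close>

lemma max_stable_prob_le_power:
  fixes X :: "'t \<Rightarrow> 'w \<Rightarrow> real"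
  assumes rf: "random_field M X" and ms: "max_stable M X" and n: "n \<ge> 1" and A: "finite A"
  shows "\<P>(\<omega> in M. \<forall>t\<in>A. X t \<omega> \<le> x) = \<P>(\<omega> in M. \<forall>t\<in>A. X t \<omega> \<le> real n * x) ^ n"
proof -
  let ?N = "Pi\<^sub>M {..<n} (\<lambda>_. M)"
  interpret prob_space M using rf by (simp add: random_field_def)
  have X [measurable]: "X t \<in> borel_measurable M" for t
    using rf by (simp add: random_field_def)
  interpret N: finite_product_prob_space "\<lambda>_. M" "{..<n}"
    by standard simp
  have comp [measurable]: "(\<lambda>\<omega>. \<omega> i) \<in> measurable ?N M" if "i < n" for i
    using that by simp
  define B where "B = {\<omega> \<in> space M. \<forall>t\<in>A. X t \<omega> \<le> real n * x}"
  have B: "B \<in> sets M" unfolding B_def using A by measurable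
  have fdd: "same_fdd ?N (\<lambda>t \<omega>. (MAX i\<in>{..<n}. X t (\<omega> i)) / real n) M X"
    using ms n independent_copies_PiM[OF rf n] unfolding max_stable_def by blast
  have "\<P>(\<omega> in M. \<forall>t\<in>A. X t \<omega> \<le> x)
      = \<P>(\<omega> in ?N. \<forall>t\<in>A. (MAX i\<in>{..<n}. X t (\<omega> i)) / real n \<le> x)"
    by (rule same_fdd_prob_le[OF fdd A, symmetric])
      (auto intro!: borel_measurable_divide borel_measurable_Max measurable_compose[OF comp X])
  also have "{\<omega> \<in> space ?N. \<forall>t\<in>A. (MAX i\<in>{..<n}. X t (\<omega> i)) / real n \<le> x} = Pi\<^sub>E {..<n} (\<lambda>_. B)"
  proof -
    have "(MAX i\<in>{..<n}. X t (\<omega> i)) / real n \<le> x \<longleftrightarrow> (\<forall>i<n. X t (\<omega> i) \<le> real n * x)" for t \<omega>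
    proof -
      have "(MAX i\<in>{..<n}. X t (\<omega> i)) / real n \<le> x \<longleftrightarrow> (MAX i\<in>{..<n}. X t (\<omega> i)) \<le> real n * x"
        using n by (simp add: divide_simps mult.commute)
      also have "\<dots> \<longleftrightarrow> (\<forall>i<n. X t (\<omega> i) \<le> real n * x)"
        using n by (subst Max_le_iff) (auto simp: lessThan_empty_iff)
      finally show ?thesis .
    qed
    then show ?thesis
      unfolding B_def space_PiM by (auto simp: PiE_iff extensional_def)
  qed
  also have "measure ?N (Pi\<^sub>E {..<n} (\<lambda>_. B)) = prob B ^ n"
    using B by (subst N.finite_measure_PiM_emb) auto
  finally show ?thesis by (simp add: B_def)
qed

section \<open>Extremal coefficients as exponents of the law of a maximum\<close>

text \<open>Monotonicity stands in for continuity: homogeneity under integers settles the positive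
  rationals, and rationals just above and just below \<open>x\<close> give the two
  inequalities.\<close>

lemma antimono_homogeneous_eq:
  fixes g :: "real \<Rightarrow> real"
  assumes hom: "\<And>n x. n \<ge> 1 \<Longrightarrow> x > 0 \<Longrightarrow> g x = real n * g (real n * x)"
    and anti: "\<And>x y. 0 < x \<Longrightarrow> x \<le> y \<Longrightarrow> g y \<le> g x"
    and nonneg: "\<And>x. x > 0 \<Longrightarrow> g x \<ge> 0"
    and x: "x > 0"
  shows "x * g x = g 1"
proof -
  have rat: "q * g q = g 1" if "q \<in> \<rat>" "q > 0" for q
  proof -
    obtain m n :: nat where "n \<noteq> 0" "\<bar>q\<bar> = real m / real n"
      using Rats_abs_nat_div_natE[OF \<open>q \<in> \<rat>\<close>] by metis
    then have mn: "m > 0" "n > 0" "q = real m / real n"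
      using \<open>q > 0\<close> by (auto intro: gr0I)
    \<comment> \<open>Scaling \<open>q\<close> by \<open>n\<close> and scaling 1 by \<open>m\<close>
      both lead to \<open>m\<close>, so \<open>g q\<close> and \<open>g 1\<close> are both multiples
      of \<open>g m\<close>.\<close>
    then have "real n * q = real m" by simp
    then have "g q = real n * g (real m)"
      using hom[of n q] mn(2) \<open>q > 0\<close> by simp
    moreover have "g 1 = real m * g (real m)"
      using hom[of m 1] mn(1) by simp
    ultimately show ?thesis using mn by simp
  qed
  have "g 1 \<le> x * g x"
  proof (rule field_le_epsilon)
    fix e :: real assume e: "e > 0"
    have gx: "g x \<ge> 0" using nonneg x by simp
    \<comment> \<open>Multiplied by \<open>g x\<close>, this margin stays below \<open>e\<close>;
      the added 1 keeps the denominator positive when \<open>g x = 0\<close>.\<close>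
    have "x < x + e / (g x + 1)" using e gx by simp
    then obtain q where q: "q \<in> \<rat>" "x < q" "q < x + e / (g x + 1)"
      using Rats_dense_in_real by blast
    have "g 1 = q * g q" using rat[of q] q x by simp
    also have "\<dots> \<le> q * g x" using anti[of x q] q x by (intro mult_left_mono) auto
    also have "\<dots> \<le> (x + e / (g x + 1)) * g x" using q gx by (intro mult_right_mono) auto
    also have "\<dots> \<le> x * g x + e"
      using e gx by (simp add: field_simps)
    finally show "g 1 \<le> x * g x + e" .
  qed
  moreover have "x * g x \<le> g 1"
  proof (rule field_le_epsilon)
    fix e :: real assume e: "e > 0"
    have gx: "g x \<ge> 0" using nonneg x by simp
    \<comment> \<open>The maximum with 0 keeps the rational positive, as \<open>rat\<close> and
      \<open>anti\<close> require.\<close>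
    have "max 0 (x - e / (g x + 1)) < x" using e gx x by simp
    then obtain q where q: "q \<in> \<rat>" "max 0 (x - e / (g x + 1)) < q" "q < x"
      using Rats_dense_in_real by blast
    have "x * g x \<le> (q + e / (g x + 1)) * g x" using q gx by (intro mult_right_mono) auto
    also have "\<dots> \<le> q * g x + e"
      using e gx by (simp add: field_simps)
    also have "q * g x \<le> q * g q" using anti[of q x] q by (intro mult_left_mono) auto
    also have "q * g q = g 1" using rat[of q] q by simp
    finally show "x * g x \<le> g 1 + e" by simp
  qed
  ultimately show ?thesis by simp
qed

locale max_stable_frechet_field = prob_space M for M :: "'w measure" +
  fixes X :: "'t \<Rightarrow> 'w \<Rightarrow> real"
  assumes rv [measurable]: "\<And>t. X t \<in> borel_measurable M"
    and frechet: "standard_frechet M X"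
    and stable: "max_stable M X"
begin

abbreviation \<theta> :: "'t set \<Rightarrow> real" where
  "\<theta> \<equiv> extremal_coefficient M X"

lemma prob_le_one_point: "x > 0 \<Longrightarrow> \<P>(\<omega> in M. X t \<omega> \<le> x) = exp (- 1 / x)"
  using frechet by (simp add: standard_frechet_def)

text \<open>Logarithms are meaningful only after this, since \<open>ln 0 = 0\<close> in HOL. At a
  large level the union bound makes the probability positive, and the power identity carries this
  back to \<open>x\<close>.\<close>

lemma prob_le_pos:
  assumes A: "finite A" and x: "x > 0"
  shows "\<P>(\<omega> in M. \<forall>t\<in>A. X t \<omega> \<le> x) > 0"
proof -
  \<comment> \<open>For \<open>y = n * x > card A\<close> the union bound is at most
    \<open>card A / y < 1\<close>; the bound by 1 provides \<open>n \<ge> 1\<close> for the power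
    identity.\<close>
  obtain n :: nat where n: "real n > max 1 (real (card A) / x)"
    using reals_Archimedean2 by blast
  define y where "y = real n * x"
  have y: "y > 0" "real (card A) < y"
    using n x by (auto simp: y_def divide_simps mult.commute)
  have "1 - \<P>(\<omega> in M. \<forall>t\<in>A. X t \<omega> \<le> y) = \<P>(\<omega> in M. \<not> (\<forall>t\<in>A. X t \<omega> \<le> y))"
    using A by (intro prob_neg[symmetric]) measurable
  also have "\<dots> \<le> prob (\<Union>t\<in>A. {\<omega>\<in>space M. \<not> X t \<omega> \<le> y})"
    using A by (intro finite_measure_mono) auto
  also have "\<dots> \<le> (\<Sum>t\<in>A. \<P>(\<omega> in M. \<not> X t \<omega> \<le> y))"
    using A by (intro finite_measure_subadditive_finite) auto
  also have "\<dots> = (\<Sum>t\<in>A. 1 - exp (- 1 / y))"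
    using y by (intro sum.cong refl, subst prob_neg) (auto simp: prob_le_one_point)
  also have "\<dots> \<le> (\<Sum>t\<in>A. 1 / y)"
    using exp_ge_add_one_self[of "- 1 / y"] by (intro sum_mono) simp
  also have "\<dots> < 1" using y by (simp add: divide_simps)
  finally have "\<P>(\<omega> in M. \<forall>t\<in>A. X t \<omega> \<le> y) > 0" by simp
  moreover have "\<P>(\<omega> in M. \<forall>t\<in>A. X t \<omega> \<le> x) = \<P>(\<omega> in M. \<forall>t\<in>A. X t \<omega> \<le> y) ^ n"
    unfolding y_def using n A rv stable prob_space_axioms
    by (intro max_stable_prob_le_power) (auto simp: random_field_def)
  ultimately show ?thesis by simp
qed

text \<open>Under \<open>- ln\<close> the power identity becomes homogeneity under positive
  integers, so \<open>antimono_homogeneous_eq\<close> applies.\<close>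

lemma prob_le_homogeneous:
  assumes A: "finite A" and x: "x > 0"
  shows "- x * ln (\<P>(\<omega> in M. \<forall>t\<in>A. X t \<omega> \<le> x)) = - ln (\<P>(\<omega> in M. \<forall>t\<in>A. X t \<omega> \<le> 1))"
proof -
  define G where "G x = \<P>(\<omega> in M. \<forall>t\<in>A. X t \<omega> \<le> x)" for x
  have pos: "G x > 0" if "x > 0" for x
    using prob_le_pos[OF A that] by (simp add: G_def)
  have "x * (- ln (G x)) = - ln (G 1)"
  proof (rule antimono_homogeneous_eq[where g = "\<lambda>x. - ln (G x)"])
    fix n :: nat and x :: real assume n: "n \<ge> 1" and x: "x > 0"
    have "G x = G (real n * x) ^ n"
      unfolding G_def using n A rv stable prob_space_axioms
      by (intro max_stable_prob_le_power) (auto simp: random_field_def)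
    then show "- ln (G x) = real n * - ln (G (real n * x))"
      using pos[of "real n * x"] n x by (simp add: ln_realpow)
  next
    fix x y :: real assume "0 < x" "x \<le> y"
    have "G x \<le> G y"
      unfolding G_def using A \<open>x \<le> y\<close> by (intro finite_measure_mono) (auto dest: bspec)
    then show "- ln (G y) \<le> - ln (G x)"
      using pos \<open>0 < x\<close> \<open>x \<le> y\<close> by simp
  next
    fix x :: real assume "x > 0"
    then show "0 \<le> - ln (G x)"
      using pos[of x] prob_le_1 by (simp add: G_def)
  qed (rule x)
  then show ?thesis by (simp add: G_def)
qed

text \<open>Homogeneity supplies the constant demanded by the definite description, and the instance
  at 1 shows its uniqueness. For empty \<open>A\<close> the convention
  \<open>\<theta> {} = 0\<close> matches the probability 1.\<close>

lemma prob_le: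
  assumes A: "finite A" and x: "x > 0"
  shows "\<P>(\<omega> in M. \<forall>t\<in>A. X t \<omega> \<le> x) = exp (- \<theta> A / x)"
proof (cases "A = {}")
  case True
  then show ?thesis by (simp add: extremal_coefficient_def prob_space)
next
  case False
  let ?c = "- ln (\<P>(\<omega> in M. \<forall>t\<in>A. X t \<omega> \<le> 1))"
  have eq: "{\<omega>\<in>space M. (MAX t\<in>A. X t \<omega>) \<le> y} = {\<omega>\<in>space M. \<forall>t\<in>A. X t \<omega> \<le> y}" for y
    using False A by auto
  have "\<theta> A = (THE c. \<forall>x>0. c = - x * ln (\<P>(\<omega> in M. \<forall>t\<in>A. X t \<omega> \<le> x)))"
    using False by (simp add: extremal_coefficient_def eq)
  also have "\<dots> = ?c"
  proof (rule the_equality)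
    show "\<forall>x>0. ?c = - x * ln (\<P>(\<omega> in M. \<forall>t\<in>A. X t \<omega> \<le> x))"
      by (intro allI impI prob_le_homogeneous[OF A, symmetric])
  next
    fix c assume "\<forall>x>0. c = - x * ln (\<P>(\<omega> in M. \<forall>t\<in>A. X t \<omega> \<le> x))"
    from this[rule_format, of 1] show "c = ?c" by simp
  qed
  also have "\<dots> = - x * ln (\<P>(\<omega> in M. \<forall>t\<in>A. X t \<omega> \<le> x))"
    using prob_le_homogeneous[OF A x] by simp
  finally show ?thesis
    using x prob_le_pos[OF A x] by simp
qed

lemma theta_empty: "\<theta> {} = 0"
  by (simp add: extremal_coefficient_def)

lemma theta_singleton: "\<theta> {t} = 1"
  using prob_le[of "{t}" 1] prob_le_one_point[of 1 t] by simp

section \<open>Comparing extremal coefficients of finite families\<close>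

lemma theta_mono:
  assumes "A \<subseteq> B" "finite B"
  shows "\<theta> A \<le> \<theta> B"
proof -
  have "\<P>(\<omega> in M. \<forall>t\<in>B. X t \<omega> \<le> 1) \<le> \<P>(\<omega> in M. \<forall>t\<in>A. X t \<omega> \<le> 1)"
    using assms finite_subset[OF assms] by (intro finite_measure_mono) auto
  then show ?thesis
    using assms finite_subset[OF assms] by (simp add: prob_le)
qed

lemma theta_pair_ge_1: "\<theta> {s, t} \<ge> 1"
  using theta_mono[of "{s}" "{s, t}"] by (simp add: theta_singleton)

text \<open>By \<open>exp (- a / x) = 1 - a / x + O(1 / x^2)\<close>, multiplying by
  \<open>x\<close> turns differences of probabilities into differences of extremal
  coefficients.\<close>

lemma tendsto_exp_diff_at_top:
  "((\<lambda>x. x * (exp (- a / x) - exp (- b / x))) \<longlongrightarrow> b - a) at_top" for a b :: real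
  by real_asymp

text \<open>Multiply the union bound by \<open>x\<close> and let \<open>x\<close> tend to infinity.\<close>

lemma theta_image_le:
  assumes I: "finite I"
  shows "\<theta> (f ` I) \<le> \<theta> (g ` I) + (\<Sum>i\<in>I. \<theta> {g i, f i} - 1)"
proof -
  \<comment> \<open>Adjoining the points \<open>f i\<close> to the points \<open>g i\<close> makes
    the two events nested, so the difference of probabilities is the probability of a difference;
    \<open>theta_mono\<close> finally returns from \<open>?U\<close> to the image of
    \<open>f\<close>.\<close>
  let ?U = "g ` I \<union> f ` I"
  have fin: "finite ?U" using I by simp
  have "x * (exp (- \<theta> (g ` I) / x) - exp (- \<theta> ?U / x))
      \<le> (\<Sum>i\<in>I. x * (exp (- 1 / x) - exp (- \<theta> {g i, f i} / x)))" if x: "x > 0" for x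
  proof -
    let ?P = "\<lambda>A. {\<omega>\<in>space M. \<forall>t\<in>A. X t \<omega> \<le> x}"
    have meas: "?P A \<in> events" if "finite A" for A using that by measurable
    have "exp (- \<theta> (g ` I) / x) - exp (- \<theta> ?U / x) = prob (?P (g ` I)) - prob (?P ?U)"
      using I x fin by (simp only: prob_le finite_imageI)
    also have "\<dots> = prob (?P (g ` I) - ?P ?U)"
      using I fin by (intro finite_measure_Diff[symmetric] meas) auto
    also have "\<dots> \<le> prob (\<Union>i\<in>I. ?P {g i} - ?P {g i, f i})"
      using I by (intro finite_measure_mono sets.finite_UN sets.Diff meas) auto
    also have "\<dots> \<le> (\<Sum>i\<in>I. prob (?P {g i} - ?P {g i, f i}))"
      using I by (intro finite_measure_subadditive_finite) (auto intro!: sets.Diff meas)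
    also have "\<dots> = (\<Sum>i\<in>I. prob (?P {g i}) - prob (?P {g i, f i}))"
      by (intro sum.cong refl finite_measure_Diff meas) auto
    also have "\<dots> = (\<Sum>i\<in>I. exp (- 1 / x) - exp (- \<theta> {g i, f i} / x))"
      using x by (simp only: prob_le finite.intros theta_singleton)
    finally show ?thesis
      using x by (simp add: sum_distrib_left[symmetric] del: minus_divide_left)
  qed
  then have "eventually (\<lambda>x. x * (exp (- \<theta> (g ` I) / x) - exp (- \<theta> ?U / x))
      \<le> (\<Sum>i\<in>I. x * (exp (- 1 / x) - exp (- \<theta> {g i, f i} / x)))) at_top"
    by (rule eventually_mono[OF eventually_gt_at_top[of 0]])
  then have "\<theta> ?U - \<theta> (g ` I) \<le> (\<Sum>i\<in>I. \<theta> {g i, f i} - 1)"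
    by (rule tendsto_le[rotated 3])
       (intro trivial_limit_at_top_linorder tendsto_sum tendsto_exp_diff_at_top)+
  moreover have "\<theta> (f ` I) \<le> \<theta> ?U"
    using fin by (intro theta_mono) auto
  ultimately show ?thesis by simp
qed

lemma abs_theta_image_diff_le:
  assumes "finite I"
  shows "\<bar>\<theta> (f ` I) - \<theta> (g ` I)\<bar> \<le> (\<Sum>i\<in>I. \<theta> {f i, g i} - 1)"
proof -
  have "{g i, f i} = {f i, g i}" for i by blast
  then show ?thesis
    using theta_image_le[OF assms, of f g] theta_image_le[OF assms, of g f] by simp
qed

section \<open>The extremal correlation\<close>

text \<open>The mass at \<open>x\<close> is at most that of the interval from \<open>y\<close> to
  \<open>x\<close>, which vanishes as \<open>y\<close> increases to \<open>x\<close>. This lets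
  strict exceedances replace the non-strict ones in the extremal correlation.\<close>

lemma AE_neq:
  assumes x: "x > 0"
  shows "AE \<omega> in M. X t \<omega> \<noteq> x"
proof -
  have "eventually (\<lambda>y. \<P>(\<omega> in M. X t \<omega> = x) \<le> exp (- 1 / x) - exp (- 1 / y)) (at_left x)"
    using eventually_at_left_real[OF x]
  proof eventually_elim
    fix y assume y: "y \<in> {0<..<x}"
    have "\<P>(\<omega> in M. X t \<omega> = x) \<le> prob ({\<omega>\<in>space M. X t \<omega> \<le> x} - {\<omega>\<in>space M. X t \<omega> \<le> y})"
      using y by (intro finite_measure_mono) auto
    also have "\<dots> = exp (- 1 / x) - exp (- 1 / y)"
      using x y by (subst finite_measure_Diff) (auto simp: prob_le_one_point)
    finally show "\<P>(\<omega> in M. X t \<omega> = x) \<le> exp (- 1 / x) - exp (- 1 / y)" .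
  qed
  moreover have "((\<lambda>y. exp (- 1 / x) - exp (- 1 / y)) \<longlongrightarrow> exp (- 1 / x) - exp (- 1 / x)) (at_left x)"
    using x by (intro tendsto_intros) auto
  ultimately have "\<P>(\<omega> in M. X t \<omega> = x) \<le> exp (- 1 / x) - exp (- 1 / x)"
    by (intro tendsto_le[OF _ _ tendsto_const]) auto
  then have "\<P>(\<omega> in M. X t \<omega> = x) = 0"
    by (simp add: measure_le_0_iff)
  then show ?thesis
    by (subst (asm) prob_Collect_eq_0) auto
qed

text \<open>To first order, the joint exceedance probability is
  \<open>(2 - \<theta> {s, t}) / x\<close> and that of the condition is
  \<open>1 / x\<close>.\<close>

lemma extremal_correlation_eq: "extremal_correlation M X s t = 2 - \<theta> {s, t}"
proof -
  have "\<P>(\<omega> in M. X s \<omega> \<ge> x \<bar> X t \<omega> \<ge> x)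
      = (1 - 2 * exp (- 1 / x) + exp (- \<theta> {s, t} / x)) / (1 - exp (- 1 / x))" if x: "x > 0" for x
  proof -
    let ?P = "\<lambda>A. {\<omega>\<in>space M. \<forall>t\<in>A. X t \<omega> \<le> x}"
    have meas: "?P A \<in> events" if "finite A" for A using that by measurable
    have t: "\<P>(\<omega> in M. X t \<omega> > x) = 1 - exp (- 1 / x)"
      using prob_neg[of "\<lambda>\<omega>. X t \<omega> \<le> x"] prob_le_one_point[OF x] by (simp add: not_le)
    \<comment> \<open>Probabilities are known for upper bounds only; the set removed here is the
      event \<open>X s \<le> x < X t\<close>.\<close>
    have eq: "{\<omega>\<in>space M. X s \<omega> > x \<and> X t \<omega> > x} = {\<omega>\<in>space M. X t \<omega> > x} - (?P {s} - ?P {s, t})"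
      by auto
    have "\<P>(\<omega> in M. X s \<omega> > x \<and> X t \<omega> > x)
        = \<P>(\<omega> in M. X t \<omega> > x) - prob (?P {s} - ?P {s, t})"
      unfolding eq by (rule finite_measure_Diff) auto
    also have "prob (?P {s} - ?P {s, t}) = prob (?P {s}) - prob (?P {s, t})"
      by (intro finite_measure_Diff meas) auto
    also have "\<dots> = exp (- 1 / x) - exp (- \<theta> {s, t} / x)"
      using x by (simp only: prob_le finite.intros theta_singleton)
    finally have "\<P>(\<omega> in M. X s \<omega> > x \<and> X t \<omega> > x) = 1 - 2 * exp (- 1 / x) + exp (- \<theta> {s, t} / x)"
      using t by simp
    moreover have "\<P>(\<omega> in M. X s \<omega> \<ge> x \<bar> X t \<omega> \<ge> x) = \<P>(\<omega> in M. X s \<omega> > x \<bar> X t \<omega> > x)"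
    proof (rule cond_prob_eq_AE)
      have ge: "AE \<omega> in M. X r \<omega> \<ge> x \<longleftrightarrow> X r \<omega> > x" for r
        using AE_neq[OF x, of r] by eventually_elim auto
      show "AE \<omega> in M. X t \<omega> \<ge> x \<longrightarrow> (X s \<omega> \<ge> x \<longleftrightarrow> X s \<omega> > x)"
        using ge[of s] by eventually_elim simp
      show "AE \<omega> in M. X t \<omega> \<ge> x \<longleftrightarrow> X t \<omega> > x"
        by (rule ge)
    qed measurable
    ultimately show ?thesis
      using t by (simp add: cond_prob_def)
  qed
  then have "eventually (\<lambda>x. (1 - 2 * exp (- 1 / x) + exp (- \<theta> {s, t} / x)) / (1 - exp (- 1 / x))
      = \<P>(\<omega> in M. X s \<omega> \<ge> x \<bar> X t \<omega> \<ge> x)) at_top"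
    by (intro eventually_mono[OF eventually_gt_at_top[of 0]]) simp
  moreover have "((\<lambda>x. (1 - 2 * exp (- 1 / x) + exp (- c / x)) / (1 - exp (- 1 / x))) \<longlongrightarrow> 2 - c) at_top"
    for c :: real
    by real_asymp
  ultimately have "((\<lambda>x. \<P>(\<omega> in M. X s \<omega> \<ge> x \<bar> X t \<omega> \<ge> x)) \<longlongrightarrow> 2 - \<theta> {s, t}) at_top"
    by (rule Lim_transform_eventually[rotated])
  then show ?thesis
    unfolding extremal_correlation_def by (intro tendsto_Lim) auto
qed

end

section \<open>Continuity of extremal coefficients and correlations\<close>

text \<open>If \<open>X t \<le> 1 < X (u n)\<close>, then either \<open>X t\<close> lies between
  \<open>1 - \<delta>\<close> and 1 or the two values differ by more than \<delta>. The first
  probability is small with \<delta>, the second tends to 0 with \<open>n\<close>.\<close>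

lemma isCont_theta_pair:
  fixes X :: "'t::metric_space \<Rightarrow> 'w \<Rightarrow> real"
  assumes "max_stable_frechet_field M X" and sc: "stochastically_continuous M X"
  shows "isCont (\<lambda>s. extremal_coefficient M X {s, t}) t"
  unfolding continuous_at_sequentially
proof (intro allI impI)
  interpret max_stable_frechet_field M X by fact
  fix u assume u: "u \<longlonglongrightarrow> t"
  have bound: "exp (- 1) - exp (- \<theta> {u n, t})
      \<le> (exp (- 1) - exp (- 1 / (1 - \<delta>))) + \<P>(\<omega> in M. \<bar>X (u n) \<omega> - X t \<omega>\<bar> > \<delta>)"
    if \<delta>: "0 < \<delta>" "\<delta> < 1" for \<delta> n
  proof -
    let ?P = "\<lambda>A. {\<omega>\<in>space M. \<forall>t\<in>A. X t \<omega> \<le> 1}"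
    let ?Q = "{\<omega>\<in>space M. X t \<omega> \<le> 1} - {\<omega>\<in>space M. X t \<omega> \<le> 1 - \<delta>}"
    have meas: "?P A \<in> events" if "finite A" for A using that by measurable
    have "exp (- 1) - exp (- \<theta> {u n, t}) = prob (?P {t}) - prob (?P {u n, t})"
      by (simp only: prob_le finite.intros theta_singleton zero_less_one div_by_1)
    also have "\<dots> = prob (?P {t} - ?P {u n, t})"
      by (intro finite_measure_Diff[symmetric] meas) auto
    also have "\<dots> \<le> prob (?Q \<union> {\<omega>\<in>space M. \<bar>X (u n) \<omega> - X t \<omega>\<bar> > \<delta>})"
      by (intro finite_measure_mono) auto
    also have "\<dots> \<le> prob ?Q + \<P>(\<omega> in M. \<bar>X (u n) \<omega> - X t \<omega>\<bar> > \<delta>)"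
      by (intro measure_Un_le) auto
    also have "prob ?Q = exp (- 1) - exp (- 1 / (1 - \<delta>))"
      using \<delta> by (subst finite_measure_Diff) (auto simp: prob_le_one_point)
    finally show ?thesis .
  qed
  have "(\<lambda>n. exp (- 1) - exp (- \<theta> {u n, t})) \<longlonglongrightarrow> 0"
  proof (rule tendstoI)
    fix e :: real assume e: "e > 0"
    \<comment> \<open>First \<delta> is fixed, by continuity of the Frechet distribution function at
      1; only then does \<open>n\<close> tend to infinity.\<close>
    have "((\<lambda>\<delta>. exp (- 1) - exp (- 1 / (1 - \<delta>))) \<longlongrightarrow> exp (- 1) - exp (- 1 / (1 - 0))) (at_right (0::real))"
      by (intro tendsto_intros) auto
    then have "eventually (\<lambda>\<delta>. exp (- 1) - exp (- 1 / (1 - \<delta>)) < e / 2) (at_right (0::real))"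
      using e by (intro order_tendstoD(2)) auto
    moreover have "eventually (\<lambda>\<delta>. \<delta> \<in> {0<..<1}) (at_right (0::real))"
      by (rule eventually_at_right_real) simp
    ultimately have "eventually (\<lambda>\<delta>. exp (- 1) - exp (- 1 / (1 - \<delta>)) < e / 2 \<and> \<delta> \<in> {0<..<1}) (at_right (0::real))"
      by (rule eventually_conj)
    then obtain \<delta> :: real where \<delta>: "exp (- 1) - exp (- 1 / (1 - \<delta>)) < e / 2" "0 < \<delta>" "\<delta> < 1"
      using eventually_happens[of _ "at_right (0::real)"] by auto
    have "(\<lambda>n. \<P>(\<omega> in M. \<bar>X (u n) \<omega> - X t \<omega>\<bar> > \<delta>)) \<longlonglongrightarrow> 0"
      using sc u \<delta> unfolding stochastically_continuous_def by blast
    then have "eventually (\<lambda>n. \<P>(\<omega> in M. \<bar>X (u n) \<omega> - X t \<omega>\<bar> > \<delta>) < e / 2) sequentially"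
      using e by (intro order_tendstoD(2)) auto
    then show "eventually (\<lambda>n. dist (exp (- 1) - exp (- \<theta> {u n, t})) 0 < e) sequentially"
    proof eventually_elim
      case (elim n)
      have "exp (- \<theta> {u n, t}) \<le> exp (- 1)" using theta_pair_ge_1 by simp
      then show ?case
        using bound[OF \<delta>(2,3), of n] elim \<delta>(1) by (simp add: dist_real_def)
    qed
  qed
  then have "(\<lambda>n. exp (- 1) - (exp (- 1) - exp (- \<theta> {u n, t}))) \<longlonglongrightarrow> exp (- 1) - 0"
    by (intro tendsto_diff tendsto_const)
  \<comment> \<open>The limit \<open>exp (- 1)\<close> is positive, so the logarithm is continuous
    there.\<close>
  then have "(\<lambda>n. - ln (exp (- \<theta> {u n, t}))) \<longlonglongrightarrow> - ln (exp (- 1))"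
    by (intro tendsto_minus tendsto_ln) auto
  then show "((\<lambda>s. \<theta> {s, t}) \<circ> u) \<longlonglongrightarrow> \<theta> {t, t}"
    by (simp add: comp_def theta_singleton)
qed

text \<open>\<open>abs_theta_image_diff_le\<close> reduces the claim at a tuple \<open>f\<close> to
  its coordinates: each \<open>\<theta> {g i, f i} - 1\<close> vanishes as \<open>g i\<close> tends
  to \<open>f i\<close>. That bound is indexed by positions, so it covers tuples with repeated
  points.\<close>

lemma continuous_extremal_coefficient:
  fixes X :: "'t::metric_space \<Rightarrow> 'w \<Rightarrow> real"
  assumes "max_stable_frechet_field M X" and sc: "stochastically_continuous M X"
  shows "continuous_finset_fun (extremal_coefficient M X)"
  unfolding continuous_finset_fun_def continuous_map_atin limitin_canonical_iff
proof (intro allI ballI)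
  interpret max_stable_frechet_field M X by fact
  fix m :: nat and f :: "nat \<Rightarrow> 't"
  let ?T = "product_topology (\<lambda>_. euclidean) {..<m}"
  assume f: "f \<in> topspace ?T"
  have proj: "((\<lambda>g. g i) \<longlongrightarrow> f i) (atin ?T f)" if "i < m" for i
    using continuous_map_product_projection[of i "{..<m}" "\<lambda>_. euclidean"] that f
    unfolding continuous_map_atin limitin_canonical_iff by auto
  have "((\<lambda>g. \<Sum>i<m. \<theta> {g i, f i} - 1) \<longlongrightarrow> (\<Sum>i<m. \<theta> {f i, f i} - 1)) (atin ?T f)"
    by (intro tendsto_sum tendsto_diff tendsto_const isCont_tendsto_compose[OF isCont_theta_pair] proj)
       (use assms in auto)
  then have "((\<lambda>g. \<Sum>i<m. \<theta> {g i, f i} - 1) \<longlongrightarrow> 0) (atin ?T f)"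
    by (simp add: theta_singleton)
  then have "((\<lambda>g. \<theta> (g ` {..<m}) - \<theta> (f ` {..<m})) \<longlongrightarrow> 0) (atin ?T f)"
    by (rule Lim_null_comparison[rotated]) (simp add: abs_theta_image_diff_le)
  then show "((\<lambda>g. \<theta> (g ` {..<m})) \<longlongrightarrow> \<theta> (f ` {..<m})) (atin ?T f)"
    by (simp add: Lim_null[of _ "\<theta> (f ` {..<m})"])
qed

text \<open>Sending a pair to the extensional tuple with the same two entries is continuous, and the
  image of that tuple is \<open>{s, t}\<close>.\<close>

lemma continuous_finset_fun_pair:
  fixes f :: "'t::topological_space set \<Rightarrow> real"
  assumes "continuous_finset_fun f"
  shows "continuous_on UNIV (\<lambda>(s, t). f {s, t})"
proof -
  let ?T = "product_topology (\<lambda>_. euclidean) {..<2::nat} :: (nat \<Rightarrow> 't) topology"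
  let ?g = "\<lambda>p :: 't \<times> 't. \<lambda>i\<in>{..<2::nat}. if i = 0 then fst p else snd p"
  have "continuous_map euclidean ?T ?g"
    unfolding continuous_map_componentwise
    by (auto simp: continuous_on_fst continuous_on_snd)
  moreover have "continuous_map ?T euclideanreal (\<lambda>t. f (t ` {..<2}))"
    using assms unfolding continuous_finset_fun_def by blast
  ultimately have "continuous_map euclidean euclideanreal ((\<lambda>t. f (t ` {..<2})) \<circ> ?g)"
    by (rule continuous_map_compose)
  moreover have "((\<lambda>t. f (t ` {..<2})) \<circ> ?g) = (\<lambda>(s, t). f {s, t})"
    by (auto simp: fun_eq_iff lessThan_nat_numeral lessThan_Suc numeral_2_eq_2 insert_commute)
  ultimately show ?thesis by simp
qed

section \<open>Two-dimensional laws and deviations of the associated field\<close>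

text \<open>The assumptions are symmetric in \<open>s\<close> and \<open>t\<close>, so a bound on
  the excess of one coordinate over the other yields the reverse bound by a second
  interpretation.\<close>

locale associated_pair = prob_space N for N :: "'v measure" +
  fixes \<theta> :: "'t set \<Rightarrow> real" and Y :: "'t \<Rightarrow> 'v \<Rightarrow> real" and s t :: 't
  assumes assoc: "associated_field \<theta> N Y"
    and neq: "s \<noteq> t"
    and theta: "\<theta> {} = 0" "\<theta> {s} = 1" "\<theta> {t} = 1" "\<theta> {s, t} \<ge> 1"
begin

lemma rv [measurable]: "Y r \<in> borel_measurable N"
  using assoc by (simp add: associated_field_def random_field_def)

lemma prob_le_fdd:
  assumes "finite A" "A \<noteq> {}" "\<And>r. r \<in> A \<Longrightarrow> x r > 0"
  shows "\<P>(\<omega> in N. \<forall>r\<in>A. Y r \<omega> \<le> x r)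
    = exp (- (\<Sum>L\<in>Pow A - {{}}. tau \<theta> A L * (MAX r\<in>L. 1 / x r)))"
  using assoc assms unfolding associated_field_def by blast

text \<open>For \<open>b \<le> a\<close> the terms of \<open>{t}\<close> and \<open>{s, t}\<close>
  both carry \<open>1 / b\<close>, and their weights add up to 1. What remains is the term of
  \<open>{s}\<close>, with weight \<open>\<theta> {s, t} - 1\<close> and factor
  \<open>1 / a\<close>.\<close>

lemma prob_joint_le:
  assumes "0 < b" "b \<le> a"
  shows "\<P>(\<omega> in N. Y s \<omega> \<le> a \<and> Y t \<omega> \<le> b) = exp (- (\<theta> {s, t} - 1) / a) * exp (- 1 / b)"
proof -
  let ?x = "\<lambda>r. if r = s then a else b"
  have "\<P>(\<omega> in N. Y s \<omega> \<le> a \<and> Y t \<omega> \<le> b) = \<P>(\<omega> in N. \<forall>r\<in>{s, t}. Y r \<omega> \<le> ?x r)"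
    using neq by simp
  also have "\<dots> = exp (- (\<Sum>L\<in>Pow {s, t} - {{}}. tau \<theta> {s, t} L * (MAX r\<in>L. 1 / ?x r)))"
    using assms by (intro prob_le_fdd) auto
  also have "Pow {s, t} - {{}} = {{s}, {t}, {s, t}}"
    using neq by auto
  also have "(\<Sum>L\<in>{{s}, {t}, {s, t}}. tau \<theta> {s, t} L * (MAX r\<in>L. 1 / ?x r))
      = (\<theta> {s, t} - 1) / a + (\<theta> {s, t} - 1) / b + (2 - \<theta> {s, t}) / b"
  proof -
    have "{s, t} - {s} = {t}" "{s, t} - {t} = {s}" using neq by auto
    then have "tau \<theta> {s, t} {s} = \<theta> {s, t} - 1" "tau \<theta> {s, t} {t} = \<theta> {s, t} - 1"
      "tau \<theta> {s, t} {s, t} = 2 - \<theta> {s, t}"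
      using neq theta by (simp_all add: tau_def Pow_insert insert_commute)
    moreover have "max (1 / a) (1 / b) = 1 / b"
      using assms by (simp add: max_def field_simps)
    ultimately show ?thesis
      using neq by (simp add: doubleton_eq_iff)
  qed
  also have "\<dots> = (\<theta> {s, t} - 1) / a + 1 / b"
    by (simp add: diff_divide_distrib)
  finally show ?thesis
    by (simp only: minus_add_distrib minus_divide_left exp_add)
qed

lemma prob_le:
  assumes "b > 0"
  shows "\<P>(\<omega> in N. Y t \<omega> \<le> b) = exp (- 1 / b)"
proof -
  have "\<P>(\<omega> in N. Y t \<omega> \<le> b) = \<P>(\<omega> in N. \<forall>r\<in>{t}. Y r \<omega> \<le> b)"
    by simp
  also have "\<dots> = exp (- (\<Sum>L\<in>Pow {t} - {{}}. tau \<theta> {t} L * (MAX r\<in>L. 1 / b)))"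
    using assms by (intro prob_le_fdd) auto
  also have "Pow {t} - {{}} = {{t}}" by auto
  finally show ?thesis
    using theta by (simp add: tau_def Pow_insert)
qed

text \<open>The defining formula covers positive thresholds only, so the threshold 0 is reached by
  letting \<open>b\<close> decrease to 0.\<close>

lemma prob_le_0: "\<P>(\<omega> in N. Y t \<omega> \<le> 0) = 0"
proof -
  have "\<P>(\<omega> in N. Y t \<omega> \<le> 0) \<le> exp (- 1 / b)" if "b > 0" for b
    unfolding prob_le[OF that, symmetric] using that by (intro finite_measure_mono) auto
  then have "eventually (\<lambda>b. \<P>(\<omega> in N. Y t \<omega> \<le> 0) \<le> exp (- 1 / b)) (at_right 0)"
    by (auto simp: eventually_at_filter)
  moreover have "((\<lambda>b::real. exp (- 1 / b)) \<longlongrightarrow> 0) (at_right 0)"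
    by real_asymp
  ultimately have "\<P>(\<omega> in N. Y t \<omega> \<le> 0) \<le> 0"
    by (intro tendsto_le[OF _ _ tendsto_const]) auto
  then show ?thesis by (simp add: measure_le_0_iff)
qed

text \<open>Cut the event along the grid \<open>k\<epsilon> < Y\<^sub>t \<le> (k + 1)\<epsilon>\<close>. On such a strip the event forces
  \<open>Y\<^sub>s > (k + 1)\<epsilon>\<close>, and since the thresholds for \<open>Y\<^sub>s\<close> are never below those for \<open>Y\<^sub>t\<close>, the joint
  distribution function factorises there.\<close>

lemma prob_exceed_le:
  assumes \<epsilon>: "\<epsilon> > 0"
  shows "\<P>(\<omega> in N. Y s \<omega> > Y t \<omega> + \<epsilon>) \<le> 1 - exp (- ((\<theta> {s, t} - 1) / \<epsilon>))"
proof -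
  define \<eta> where "\<eta> = \<theta> {s, t} - 1"
  define c where "c = 1 - exp (- \<eta> / \<epsilon>)"
  define x where "x k = real k * \<epsilon>" for k
  define H where "H k = \<P>(\<omega> in N. Y t \<omega> \<le> x k)" for k
  define E where "E k = {\<omega>\<in>space N. x k < Y t \<omega> \<and> Y t \<omega> \<le> x (Suc k) \<and> x (Suc k) < Y s \<omega>}" for k
  have \<eta>: "\<eta> \<ge> 0" using theta by (simp add: \<eta>_def)
  have xS: "x (Suc k) = x k + \<epsilon>" "x k \<ge> 0" for k
    using \<epsilon> by (simp_all add: x_def algebra_simps)
  have E_meas: "E k \<in> events" for k
    unfolding E_def by measurable
  have H0: "H 0 = 0" using prob_le_0 by (simp add: H_def x_def)
  \<comment> \<open>At \<open>k = 0\<close> the threshold is 0, outside the scope of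
    \<open>prob_joint_le\<close>; both sides vanish there because \<open>H 0 = 0\<close>.\<close>
  have joint: "\<P>(\<omega> in N. Y s \<omega> \<le> a \<and> Y t \<omega> \<le> x k) = exp (- \<eta> / a) * H k" if "x k \<le> a" for a k
  proof (cases "k = 0")
    case True
    have "\<P>(\<omega> in N. Y s \<omega> \<le> a \<and> Y t \<omega> \<le> x k) \<le> H k"
      unfolding H_def by (intro finite_measure_mono) auto
    then show ?thesis using H0 True by (simp add: measure_le_0_iff)
  next
    case False
    then have "x k > 0" using \<epsilon> by (simp add: x_def)
    then show ?thesis
      using that by (simp add: prob_joint_le H_def prob_le \<eta>_def)
  qed
  have H_mono: "H k \<le> H (Suc k)" for k
    unfolding H_def using xS[of k] \<epsilon> by (intro finite_measure_mono) auto
  have E_le: "prob (E k) \<le> c * (H (Suc k) - H k)" for k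
  proof -
    let ?a = "x (Suc k)"
    let ?S = "\<lambda>k. {\<omega>\<in>space N. Y t \<omega> \<le> x k}"
    let ?J = "\<lambda>k. {\<omega>\<in>space N. Y s \<omega> \<le> ?a \<and> Y t \<omega> \<le> x k}"
    \<comment> \<open>The strip minus its part with \<open>Y s \<le> ?a\<close>: all differences are
      of nested sets, so only distribution functions occur.\<close>
    have "E k = (?S (Suc k) - ?S k) - (?J (Suc k) - ?J k)"
      unfolding E_def by auto
    then have "prob (E k) = prob (?S (Suc k) - ?S k) - prob (?J (Suc k) - ?J k)"
      by (simp only:) (intro finite_measure_Diff, auto)
    also have "prob (?S (Suc k) - ?S k) = H (Suc k) - H k"
      unfolding H_def using xS[of k] \<epsilon> by (intro finite_measure_Diff) auto
    also have "prob (?J (Suc k) - ?J k) = prob (?J (Suc k)) - prob (?J k)"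
      using xS[of k] \<epsilon> by (intro finite_measure_Diff) auto
    also have "\<dots> = exp (- \<eta> / ?a) * (H (Suc k) - H k)"
      using joint[of "Suc k" ?a] joint[of k ?a] xS[of k] \<epsilon> by (simp add: right_diff_distrib)
    finally have "prob (E k) = (1 - exp (- \<eta> / ?a)) * (H (Suc k) - H k)"
      by (simp add: algebra_simps)
    \<comment> \<open>Every threshold \<open>?a\<close> is at least \<epsilon>, so the constant
      \<open>c\<close> of the first strip serves for all strips and the increments of
      \<open>H\<close> telescope.\<close>
    moreover have "\<eta> / ?a \<le> \<eta> / \<epsilon>"
      using xS[of k] \<epsilon> \<eta> by (intro divide_left_mono) auto
    ultimately show ?thesis
      using H_mono[of k] unfolding c_def by (auto intro!: mult_right_mono)
  qed
  have "(\<lambda>k. exp (- 1 / (real k * \<epsilon>))) \<longlonglongrightarrow> 1"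
    using \<epsilon> by real_asymp
  \<comment> \<open>The two sides differ at \<open>k = 0\<close>: division by zero makes the
    exponential 1, whereas \<open>H 0 = 0\<close>.\<close>
  moreover have "eventually (\<lambda>k. exp (- 1 / (real k * \<epsilon>)) = H k) sequentially"
    using eventually_gt_at_top[of 0] by eventually_elim (use \<epsilon> in \<open>simp add: H_def x_def prob_le\<close>)
  ultimately have "H \<longlonglongrightarrow> 1"
    by (rule Lim_transform_eventually)
  then have sums: "(\<lambda>k. c * (H (Suc k) - H k)) sums c"
    using telescope_sums[of H 1] H0 sums_mult[of _ 1 c] by simp
  have summable: "summable (\<lambda>k. prob (E k))"
    using E_le sums by (intro summable_comparison_test'[OF sums_summable[OF sums], of 0]) auto
  \<comment> \<open>The strips exhaust the positive values of \<open>Y t\<close>; the remaining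
    event is null by \<open>prob_le_0\<close>.\<close>
  have "{\<omega>\<in>space N. Y s \<omega> > Y t \<omega> + \<epsilon>} \<subseteq> {\<omega>\<in>space N. Y t \<omega> \<le> 0} \<union> (\<Union>k. E k)"
  proof
    fix \<omega> assume \<omega>: "\<omega> \<in> {\<omega>\<in>space N. Y s \<omega> > Y t \<omega> + \<epsilon>}"
    show "\<omega> \<in> {\<omega>\<in>space N. Y t \<omega> \<le> 0} \<union> (\<Union>k. E k)"
    proof (cases "Y t \<omega> \<le> 0")
      case False
      \<comment> \<open>The strips are closed on the right, so \<open>k + 1\<close> is the ceiling
        of \<open>Y t \<omega> / \<epsilon>\<close>.\<close>
      define k where "k = nat (\<lceil>Y t \<omega> / \<epsilon>\<rceil> - 1)"
      have "\<lceil>Y t \<omega> / \<epsilon>\<rceil> \<ge> 1" using False \<epsilon> by (simp add: le_ceiling_iff)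
      then have k: "real k = of_int \<lceil>Y t \<omega> / \<epsilon>\<rceil> - 1" by (simp add: k_def)
      have "real k < Y t \<omega> / \<epsilon>" "Y t \<omega> / \<epsilon> \<le> real k + 1"
        unfolding k by linarith+
      then have "x k < Y t \<omega>" "Y t \<omega> \<le> x (Suc k)"
        using \<epsilon> by (simp_all add: x_def field_simps)
      then have "\<omega> \<in> E k" using \<omega> xS[of k] by (auto simp: E_def)
      then show ?thesis by blast
    qed (use \<omega> in auto)
  qed
  then have "\<P>(\<omega> in N. Y s \<omega> > Y t \<omega> + \<epsilon>) \<le> prob ({\<omega>\<in>space N. Y t \<omega> \<le> 0} \<union> (\<Union>k. E k))"
    using E_meas by (intro finite_measure_mono) auto
  also have "\<dots> \<le> \<P>(\<omega> in N. Y t \<omega> \<le> 0) + prob (\<Union>k. E k)"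
    using E_meas by (intro measure_Un_le) auto
  also have "\<dots> = prob (\<Union>k. E k)" by (simp add: prob_le_0)
  also have "\<dots> \<le> (\<Sum>k. prob (E k))"
    using E_meas summable by (intro finite_measure_subadditive_countably) auto
  also have "\<dots> \<le> c"
    using suminf_le[OF E_le summable sums_summable[OF sums]] sums_unique[OF sums] by simp
  finally show ?thesis by (simp only: c_def \<eta>_def minus_divide_left)
qed

end

text \<open>A deviation is an excess in one of two directions, each bounded by
  \<open>prob_exceed_le\<close>, hence the factor 2. Equal points are split off because
  \<open>associated_pair\<close> demands distinct ones.\<close>

lemma associated_field_prob_diff_le:
  assumes assoc: "associated_field \<theta> N Y"
    and theta: "\<theta> {} = 0" "\<And>r. \<theta> {r} = 1" "\<theta> {s, t} \<ge> 1" and \<epsilon>: "\<epsilon> > 0"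
  shows "\<P>(\<omega> in N. \<bar>Y s \<omega> - Y t \<omega>\<bar> > \<epsilon>) \<le> 2 * (1 - exp (- ((\<theta> {s, t} - 1) / \<epsilon>)))"
proof (cases "s = t")
  case True
  then show ?thesis using \<epsilon> theta(2) by simp
next
  case False
  interpret prob_space N
    using assoc by (simp add: associated_field_def random_field_def)
  interpret st: associated_pair N \<theta> Y s t
    by standard (use assoc theta False in auto)
  interpret ts: associated_pair N \<theta> Y t s
    by standard (use assoc theta False in \<open>auto simp: insert_commute\<close>)
  have "\<P>(\<omega> in N. \<bar>Y s \<omega> - Y t \<omega>\<bar> > \<epsilon>)
      = prob ({\<omega>\<in>space N. Y s \<omega> > Y t \<omega> + \<epsilon>} \<union> {\<omega>\<in>space N. Y t \<omega> > Y s \<omega> + \<epsilon>})"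
    by (rule arg_cong[where f = prob]) (auto simp: abs_if)
  also have "\<dots> \<le> \<P>(\<omega> in N. Y s \<omega> > Y t \<omega> + \<epsilon>) + \<P>(\<omega> in N. Y t \<omega> > Y s \<omega> + \<epsilon>)"
    using st.rv by (intro measure_Un_le) measurable
  also have "\<dots> \<le> 2 * (1 - exp (- ((\<theta> {s, t} - 1) / \<epsilon>)))"
    using st.prob_exceed_le[OF \<epsilon>] ts.prob_exceed_le[OF \<epsilon>]
    by (simp add: insert_commute)
  finally show ?thesis .
qed

section \<open>Continuity, deviation bound and stochastic continuity combined\<close>

theorem theorem15:
  fixes M :: "'w measure" and X :: "'t::metric_space \<Rightarrow> 'w \<Rightarrow> real"
    and \<theta> :: "'t set \<Rightarrow> real" and chi \<eta> :: "'t \<Rightarrow> 't \<Rightarrow> real"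
  assumes "random_field M X"
    and "standard_frechet M X"
    and "max_stable M X"
    and "\<theta> = extremal_coefficient M X"
    and "chi = extremal_correlation M X"
    and "\<eta> = (\<lambda>s t. 1 - chi s t)"
  shows "(stochastically_continuous M X \<longrightarrow> continuous_finset_fun \<theta>) \<and>
         (continuous_finset_fun \<theta> \<longrightarrow> continuous_on UNIV (\<lambda>(s, t). chi s t)) \<and>
         (\<forall>(N :: 'v measure) Xstar. associated_field \<theta> N Xstar \<longrightarrow>
            (\<forall>s t. \<forall>\<epsilon>>0.
               \<P>(\<omega> in N. \<bar>Xstar s \<omega> - Xstar t \<omega>\<bar> > \<epsilon>) \<le> 2 * (1 - exp (- (\<eta> s t / \<epsilon>))) \<and>
               2 * (1 - exp (- (\<eta> s t / \<epsilon>))) \<le> 2 / \<epsilon> * \<eta> s t) \<and>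
            (continuous_on UNIV (\<lambda>(s, t). chi s t) \<longrightarrow> stochastically_continuous N Xstar))"
proof -
  interpret F: max_stable_frechet_field M X
    using assms(1-3)
    by (auto simp: max_stable_frechet_field_def max_stable_frechet_field_axioms_def random_field_def)
  have chi: "chi = (\<lambda>s t. 2 - \<theta> {s, t})"
    using assms(4,5) F.extremal_correlation_eq by (simp add: fun_eq_iff)
  then have \<eta>: "\<eta> = (\<lambda>s t. \<theta> {s, t} - 1)"
    using assms(6) by (simp add: fun_eq_iff)
  have a1: "stochastically_continuous M X \<longrightarrow> continuous_finset_fun \<theta>"
    using continuous_extremal_coefficient F.max_stable_frechet_field_axioms assms(4) by blast
  have a2: "continuous_on UNIV (\<lambda>(s, t). chi s t)" if "continuous_finset_fun \<theta>"
    using continuous_on_diff[OF continuous_on_const[of _ 2] continuous_finset_fun_pair[OF that]]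
    by (simp add: chi case_prod_unfold)
  have b1: "\<P>(\<omega> in N. \<bar>Y s \<omega> - Y t \<omega>\<bar> > \<epsilon>) \<le> 2 * (1 - exp (- (\<eta> s t / \<epsilon>)))"
    if "associated_field \<theta> N Y" "\<epsilon> > 0" for N :: "'v measure" and Y s t \<epsilon>
    using associated_field_prob_diff_le[OF that(1) _ _ _ that(2)]
      F.theta_empty F.theta_singleton F.theta_pair_ge_1 by (simp add: \<eta> assms(4))
  \<comment> \<open>This is \<open>1 - exp (- z) \<le> z\<close> at
    \<open>z = \<eta> s t / \<epsilon>\<close>.\<close>
  have b2: "2 * (1 - exp (- (\<eta> s t / \<epsilon>))) \<le> 2 / \<epsilon> * \<eta> s t" for s t \<epsilon>
    using exp_ge_add_one_self[of "- (\<eta> s t / \<epsilon>)"] by simp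
  have c: "stochastically_continuous N Y"
    if N: "associated_field \<theta> N Y" and cont: "continuous_on UNIV (\<lambda>(s, t). chi s t)"
    for N :: "'v measure" and Y
    unfolding stochastically_continuous_def
  proof (intro allI impI)
    fix u :: "nat \<Rightarrow> 't" and t and \<epsilon> :: real
    assume u: "u \<longlonglongrightarrow> t" and \<epsilon>: "\<epsilon> > 0"
    \<comment> \<open>Continuity is applied along \<open>(u n, t)\<close>, whose limit is the
      diagonal point \<open>(t, t)\<close>, where \<open>chi\<close> equals 1.\<close>
    have "(\<lambda>n. (\<lambda>(s, t). chi s t) (u n, t)) \<longlonglongrightarrow> (\<lambda>(s, t). chi s t) (t, t)"
      by (rule continuous_on_tendsto_compose[OF cont tendsto_Pair[OF u tendsto_const]]) auto
    then have "(\<lambda>n. 2 / \<epsilon> * (1 - chi (u n) t)) \<longlonglongrightarrow> 2 / \<epsilon> * (1 - chi t t)"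
      by (intro tendsto_mult tendsto_diff tendsto_const) simp
    moreover have "chi t t = 1"
      using F.theta_singleton by (simp add: chi assms(4))
    ultimately have lim: "(\<lambda>n. 2 / \<epsilon> * \<eta> (u n) t) \<longlonglongrightarrow> 0"
      by (simp add: assms(6))
    show "(\<lambda>n. \<P>(\<omega> in N. \<bar>Y (u n) \<omega> - Y t \<omega>\<bar> > \<epsilon>)) \<longlonglongrightarrow> 0"
      by (rule tendsto_sandwich[OF _ _ tendsto_const lim])
         (use order_trans[OF b1[OF N \<epsilon>] b2] in auto)
  qed
  show ?thesis
    using a1 a2 b1 b2 c by blast
qed

end
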